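(* Let $\mathcal X,\mathcal Z$ be Banach spaces, $E\in\mathcal L(\mathcal X,\mathcal Z)$, $A\colon\mathcal D(A)\subseteq\mathcal X\to\mathcal Z$ closed, linear and densely defined, with $\rho(E,A)\neq\emptyset$. (a) If the nilpotency index $p_{\rm nilp}^{(E,A)}$ exists, then the chain index $p_{\rm chain}^{(E,A)}$ also exists and $p_{\rm nilp}^{(E,A)}=p_{\rm chain}^{(E,A)}$. (b) If the nilpotency index and the resolvent index $p_{\rm res}^{(E,A)}$ exist, then $p_{\rm res}^{(E,A)}\ge p_{\rm nilp}^{(E,A)}$. (c) If the nilpotency index and the radiality index $p_{\rm rad}^{(E,A)}$ exist, then $p_{\rm rad}^{(E,A)}+1\ge p_{\rm nilp}^{(E,A)}$.
   Context: $\rho(E,A)$ is the set of $\lambda\in\mathbb C$ for which $\lambda E-A\colon\mathcal D(A)\to\mathcal Z$ has an inverse $(\lambda E-A)^{-1}\in\mathcal L(\mathcal Z,\mathcal X)$. Resolvent index: the smallest $p\in\mathbb N_0$ such that there are $\omega\in\mathbb R$, $C>0$ with $(\omega,\infty)\subseteq\rho(E,A)$ and $\|(\lambda E-A)^{-1}\|\le C|\lambda|^{p-1}$ for all $\lambda\in(\omega,\infty)$. Radiality index: the smallest $p\in\mathbb N_0$ such that there are $\omega\in\mathbb R$, $C>0$ with $(\omega,\infty)\subseteq\rho(E,A)$ and, for all $\lambda_0,\dots,\lambda_p>\omega$, both $\|(\lambda_0E-A)^{-1}E\cdots(\lambda_pE-A)^{-1}E\|$ and $\|E(\lambda_0E-A)^{-1}\cdots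 E(\lambda_pE-A)^{-1}\|$ are at most $C\prod_{k=0}^p\frac1{|\lambda_k-\omega|}$. Chain index: a chain of $(E,A)$ of length $p\in\mathbb N$ is a tuple $(x_1,\dots,x_p)\in\mathcal D(A)^{p-1}\times\mathcal X$ with $x_1\in\ker E\setminus\{0\}$, $x_k\notin\ker A$ for $k=1,\dots,p-1$, and $Ex_{k+1}=Ax_k$ for $k=1,\dots,p-1$. The chain index is the supremum of all chain lengths ($0$ if there are no chains); it exists only if this supremum is finite. Equivalence: $(E,A)\sim(\tilde E,\tilde A)$ (with $\tilde E\in\mathcal L(\tilde{\mathcal X},\tilde{\mathcal Z})$, $\tilde A$ from $\tilde{\mathcal X}$ to $\tilde{\mathcal Z}$) if there are bounded isomorphisms $P\colon\mathcal X\to\tilde{\mathcal X}$, $Q\colon\mathcal Z\to\tilde{\mathcal Z}$ with $E=Q^{-1}\tilde EP$, $A=Q^{-1}\tilde AP$. Weierstraß form: $(E,A)$ has a Weierstraß form if there is a Hilbert space $\mathcal Y=\mathcal Y^1\oplus\mathcal Y^2$ with $(E,A)\sim\left(\begin{bmatrix}I_{\mathcal Y^1}&0\\0&N\end{bmatrix},\begin{bmatrix}A_1&0\\0&I_{\mathcal Y^2}\end{bmatrix}\right)$, where $N\in\mathcal L(\mathcal Y^2)$ is nilpotent and $A_1\colon\mathcal D(A_1)\subseteq\mathcal Y^1\to\mathcal Y^1$ is linear. The degree of nilpotency of $N$ is the number $p$ with $N^p=0$ and $N^l\ne0$ for $l<p$. Nilpotency index: defined if $(E,A)$ has a Weierstraß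 form; it is the degree of nilpotency of $N$, and $0$ if $N$ is absent (i.e. $(E,A)\sim(I_{\mathcal Y^1},A_1)$). *)

theory Defs
  imports "HOL-Analysis.Analysis"
begin

class complex_normed_vector = real_normed_vector +
  fixes scaleC :: "complex \<Rightarrow> 'a \<Rightarrow> 'a"  (infixr \<open>*\<^sub>C\<close> 75)
  assumes scaleC_add_right: "c *\<^sub>C (x + y) = c *\<^sub>C x + c *\<^sub>C y"
    and scaleC_add_left: "(c + d) *\<^sub>C x = c *\<^sub>C x + d *\<^sub>C x"
    and scaleC_scaleC: "c *\<^sub>C (d *\<^sub>C x) = (c * d) *\<^sub>C x"
    and scaleC_one: "1 *\<^sub>C x = x"
    and scaleR_scaleC: "r *\<^sub>R x = complex_of_real r *\<^sub>C x"
    and norm_scaleC: "norm (c *\<^sub>C x) = cmod c * norm x"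

class complex_banach = complex_normed_vector + banach

text \<open>The axioms of \<^term>\<open>cinner\<close> force positive definiteness, since the norm is
  definite.  As with the classes above, the zero space is not excluded.\<close>

class complex_hilbert = complex_banach +
  fixes cinner :: "'a \<Rightarrow> 'a \<Rightarrow> complex"
  assumes cinner_add_left: "cinner (x + y) z = cinner x z + cinner y z"
    and cinner_scaleC_left: "cinner (c *\<^sub>C x) y = c * cinner x y"
    and cinner_commute: "cinner x y = cnj (cinner y x)"
    and cinner_self: "cinner x x = complex_of_real ((norm x)\<^sup>2)"

global_interpretation complex_vector:
  vector_space "scaleC :: complex \<Rightarrow> 'a \<Rightarrow> 'a::complex_normed_vector"
  by standard (simp_all add: scaleC_add_right scaleC_add_left scaleC_scaleC scaleC_one)

text \<open>The orthogonal direct sum of two Hilbert spaces; the library's norm on products is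
  the Euclidean one.\<close>

instantiation prod :: (complex_normed_vector, complex_normed_vector) complex_normed_vector
begin

definition "scaleC c z = (c *\<^sub>C fst z, c *\<^sub>C snd z)"

instance
proof
  fix c d :: complex and r :: real and x y :: "'a \<times> 'b"
  show "c *\<^sub>C (x + y) = c *\<^sub>C x + c *\<^sub>C y"
    by (simp add: scaleC_prod_def scaleC_add_right)
  show "(c + d) *\<^sub>C x = c *\<^sub>C x + d *\<^sub>C x"
    by (simp add: scaleC_prod_def scaleC_add_left)
  show "c *\<^sub>C (d *\<^sub>C x) = (c * d) *\<^sub>C x"
    by (simp add: scaleC_prod_def scaleC_scaleC)
  show "1 *\<^sub>C x = x"
    by (simp add: scaleC_prod_def scaleC_one)
  show "r *\<^sub>R x = complex_of_real r *\<^sub>C x"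
    by (simp add: scaleC_prod_def scaleR_prod_def scaleR_scaleC)
  show "norm (c *\<^sub>C x) = cmod c * norm x"
    by (simp add: scaleC_prod_def norm_prod_def norm_scaleC power_mult_distrib
        distrib_left [symmetric] real_sqrt_mult)
qed

end

instance prod :: (complex_banach, complex_banach) complex_banach ..

instantiation prod :: (complex_hilbert, complex_hilbert) complex_hilbert
begin

definition "cinner z w = cinner (fst z) (fst w) + cinner (snd z) (snd w)"

instance
proof
  fix c :: complex and x y z :: "'a \<times> 'b"
  show "cinner (x + y) z = cinner x z + cinner y z"
    by (simp add: cinner_prod_def cinner_add_left)
  show "cinner (c *\<^sub>C x) y = c * cinner x y"
    by (simp add: cinner_prod_def scaleC_prod_def cinner_scaleC_left distrib_left)
  show "cinner x y = cnj (cinner y x)"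
    by (simp add: cinner_prod_def cinner_commute [symmetric])
  show "cinner x x = complex_of_real ((norm x)\<^sup>2)"
    by (simp add: cinner_prod_def cinner_self norm_prod_def)
qed

end

definition bounded_clinear ::
  "('a::complex_normed_vector \<Rightarrow> 'b::complex_normed_vector) \<Rightarrow> bool" where
  "bounded_clinear f \<longleftrightarrow> bounded_linear f \<and> (\<forall>c x. f (c *\<^sub>C x) = c *\<^sub>C f x)"

definition bounded_isomorphism ::
  "('a::complex_normed_vector \<Rightarrow> 'b::complex_normed_vector) \<Rightarrow> bool" where
  "bounded_isomorphism P \<longleftrightarrow> bounded_clinear P \<and> bij P \<and> bounded_clinear (inv P)"

text \<open>An unbounded operator is given by its domain \<open>D\<close> and a function \<open>A\<close> on the whole type;
  the values of \<open>A\<close> outside \<open>D\<close> never matter.\<close>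

definition clinear_on ::
  "'a::complex_normed_vector set \<Rightarrow> ('a \<Rightarrow> 'b::complex_normed_vector) \<Rightarrow> bool" where
  "clinear_on D A \<longleftrightarrow> complex_vector.subspace D \<and>
    (\<forall>x\<in>D. \<forall>y\<in>D. A (x + y) = A x + A y) \<and>
    (\<forall>c. \<forall>x\<in>D. A (c *\<^sub>C x) = c *\<^sub>C A x)"

definition closed_operator ::
  "'a::complex_normed_vector set \<Rightarrow> ('a \<Rightarrow> 'b::complex_normed_vector) \<Rightarrow> bool" where
  "closed_operator D A \<longleftrightarrow> closed ((\<lambda>x. (x, A x)) ` D)"

definition resolvent ::
  "('a::complex_normed_vector \<Rightarrow> 'b::complex_normed_vector) \<Rightarrow> 'a set \<Rightarrow> ('a \<Rightarrow> 'b) \<Rightarrow>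
    complex \<Rightarrow> 'b \<Rightarrow> 'a" where
  "resolvent E D A l = inv_into D (\<lambda>x. l *\<^sub>C E x - A x)"

definition resolvent_set ::
  "('a::complex_normed_vector \<Rightarrow> 'b::complex_normed_vector) \<Rightarrow> 'a set \<Rightarrow> ('a \<Rightarrow> 'b) \<Rightarrow>
    complex set" where
  "resolvent_set E D A =
    {l. bij_betw (\<lambda>x. l *\<^sub>C E x - A x) D UNIV \<and> bounded_clinear (resolvent E D A l)}"

text \<open>For \<open>p = 0\<close> the exponent is \<open>-1\<close>.  The convention \<open>0 powi (-1) = 0\<close> is harmless, because
  \<open>\<omega>\<close> may always be increased.\<close>

definition resolvent_growth ::
  "('a::complex_normed_vector \<Rightarrow> 'b::complex_normed_vector) \<Rightarrow> 'a set \<Rightarrow> ('a \<Rightarrow> 'b) \<Rightarrow>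
    nat \<Rightarrow> bool" where
  "resolvent_growth E D A p \<longleftrightarrow> (\<exists>(\<omega>::real) (C::real). C > 0 \<and>
    (\<forall>l>\<omega>. complex_of_real l \<in> resolvent_set E D A) \<and>
    (\<forall>l>\<omega>. onorm (resolvent E D A (complex_of_real l)) \<le> C * \<bar>l\<bar> powi (int p - 1)))"

definition is_resolvent_index ::
  "('a::complex_normed_vector \<Rightarrow> 'b::complex_normed_vector) \<Rightarrow> 'a set \<Rightarrow> ('a \<Rightarrow> 'b) \<Rightarrow>
    nat \<Rightarrow> bool" where
  "is_resolvent_index E D A p \<longleftrightarrow>
    resolvent_growth E D A p \<and> (\<forall>q. resolvent_growth E D A q \<longrightarrow> p \<le> q)"

text \<open>\<open>compose_upto f p = f 0 \<circ> f 1 \<circ> \<dots> \<circ> f p\<close>, a product of \<open>p + 1\<close> operators.\<close>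

definition compose_upto :: "(nat \<Rightarrow> 'a \<Rightarrow> 'a) \<Rightarrow> nat \<Rightarrow> 'a \<Rightarrow> 'a" where
  "compose_upto f p = foldr (\<circ>) (map f [0..<Suc p]) id"

definition radial_bound ::
  "('a::complex_normed_vector \<Rightarrow> 'b::complex_normed_vector) \<Rightarrow> 'a set \<Rightarrow> ('a \<Rightarrow> 'b) \<Rightarrow>
    nat \<Rightarrow> bool" where
  "radial_bound E D A p \<longleftrightarrow> (\<exists>(\<omega>::real) (C::real). C > 0 \<and>
    (\<forall>l>\<omega>. complex_of_real l \<in> resolvent_set E D A) \<and>
    (\<forall>l :: nat \<Rightarrow> real. (\<forall>k\<le>p. l k > \<omega>) \<longrightarrow>
      onorm (compose_upto (\<lambda>k. resolvent E D A (complex_of_real (l k)) \<circ> E) p)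
        \<le> C * (\<Prod>k\<le>p. 1 / \<bar>l k - \<omega>\<bar>) \<and>
      onorm (compose_upto (\<lambda>k. E \<circ> resolvent E D A (complex_of_real (l k))) p)
        \<le> C * (\<Prod>k\<le>p. 1 / \<bar>l k - \<omega>\<bar>)))"

definition is_radiality_index ::
  "('a::complex_normed_vector \<Rightarrow> 'b::complex_normed_vector) \<Rightarrow> 'a set \<Rightarrow> ('a \<Rightarrow> 'b) \<Rightarrow>
    nat \<Rightarrow> bool" where
  "is_radiality_index E D A p \<longleftrightarrow>
    radial_bound E D A p \<and> (\<forall>q. radial_bound E D A q \<longrightarrow> p \<le> q)"

text \<open>The tuple \<open>(x\<^sub>1, \<dots>, x\<^sub>p)\<close> is the restriction of \<open>x\<close> to \<open>{1..p}\<close>.\<close>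

definition is_chain ::
  "('a::complex_normed_vector \<Rightarrow> 'b::complex_normed_vector) \<Rightarrow> 'a set \<Rightarrow> ('a \<Rightarrow> 'b) \<Rightarrow>
    nat \<Rightarrow> (nat \<Rightarrow> 'a) \<Rightarrow> bool" where
  "is_chain E D A p x \<longleftrightarrow> p \<ge> 1 \<and> (\<forall>k\<in>{1..<p}. x k \<in> D) \<and>
    E (x 1) = 0 \<and> x 1 \<noteq> 0 \<and>
    (\<forall>k\<in>{1..<p}. A (x k) \<noteq> 0) \<and>
    (\<forall>k\<in>{1..<p}. E (x (k + 1)) = A (x k))"

definition is_chain_index ::
  "('a::complex_normed_vector \<Rightarrow> 'b::complex_normed_vector) \<Rightarrow> 'a set \<Rightarrow> ('a \<Rightarrow> 'b) \<Rightarrow>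
    nat \<Rightarrow> bool" where
  "is_chain_index E D A p \<longleftrightarrow> (let L = {q. \<exists>x. is_chain E D A q x} in
    bdd_above L \<and> p = (if L = {} then 0 else Sup L))"

definition pencil_equiv ::
  "('a::complex_normed_vector \<Rightarrow> 'b::complex_normed_vector) \<Rightarrow> 'a set \<Rightarrow> ('a \<Rightarrow> 'b) \<Rightarrow>
   ('c::complex_normed_vector \<Rightarrow> 'd::complex_normed_vector) \<Rightarrow> 'c set \<Rightarrow> ('c \<Rightarrow> 'd) \<Rightarrow> bool" where
  "pencil_equiv E D A E' D' A' \<longleftrightarrow>
    (\<exists>P Q. bounded_isomorphism P \<and> bounded_isomorphism Q \<and>
      (\<forall>x. E x = inv Q (E' (P x))) \<and>
      D = P -` D' \<and> (\<forall>x\<in>D. A x = inv Q (A' (P x))))"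

definition nilpotency_degree :: "('a::zero \<Rightarrow> 'a) \<Rightarrow> nat \<Rightarrow> bool" where
  "nilpotency_degree N p \<longleftrightarrow> (N ^^ p) = (\<lambda>_. 0) \<and> (\<forall>l<p. (N ^^ l) \<noteq> (\<lambda>_. 0))"

text \<open>Equivalence to the block diagonal pencil \<open>(diag(I, N), diag(A\<^sub>1, I))\<close> on the Hilbert space
  \<open>'y \<times> 'w\<close>, where the second block has domain \<open>D\<^sub>1 \<times> 'w\<close>.\<close>

definition weierstrass_form ::
  "('a::complex_normed_vector \<Rightarrow> 'b::complex_normed_vector) \<Rightarrow> 'a set \<Rightarrow> ('a \<Rightarrow> 'b) \<Rightarrow>
   'y::complex_hilbert set \<Rightarrow> ('y \<Rightarrow> 'y) \<Rightarrow> ('w::complex_hilbert \<Rightarrow> 'w) \<Rightarrow> bool" where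
  "weierstrass_form E D A D1 A1 N \<longleftrightarrow>
    clinear_on D1 A1 \<and> bounded_clinear N \<and> (\<exists>p. nilpotency_degree N p) \<and>
    pencil_equiv E D A
      (\<lambda>(u, v). (u, N v)) (D1 \<times> UNIV) (\<lambda>(u, v). (A1 u, v))"

text \<open>HOL cannot quantify over types inside a formula, so the Hilbert spaces of the Weierstrass
  form are type arguments.  When they are type variables of a theorem in which this predicate
  occurs as a hypothesis, the hypothesis covers all Hilbert spaces.  The second disjunct is
  the case of an absent \<open>N\<close>; it agrees with taking for \<open>'w\<close> the zero space, on which the
  degree of nilpotency is \<open>0\<close>.\<close>

definition is_nilpotency_index ::
  "'y::complex_hilbert itself \<Rightarrow> 'w::complex_hilbert itself \<Rightarrow>
   ('a::complex_normed_vector \<Rightarrow> 'b::complex_normed_vector) \<Rightarrow> 'a set \<Rightarrow> ('a \<Rightarrow> 'b) \<Rightarrow>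
   nat \<Rightarrow> bool" where
  "is_nilpotency_index TYPE('y) TYPE('w) E D A p \<longleftrightarrow>
    (\<exists>(D1 :: 'y set) A1 (N :: 'w \<Rightarrow> 'w).
      weierstrass_form E D A D1 A1 N \<and> nilpotency_degree N p) \<or>
    (p = 0 \<and> (\<exists>(D1 :: 'y set) A1. clinear_on D1 A1 \<and> pencil_equiv E D A id D1 A1))"

end

(* The nilpotent block of a Weierstrass form embeds into the pencil: there are injective maps
   phi and psi on its space with E phi = psi N and A phi = psi. On this block the resolvent is a
   polynomial, (l E - A)^-1 psi = - phi (I + l N + ... + l^(n-1) N^(n-1)). Its leading coefficient
   phi N^(n-1) is nonzero, which forces resolvent growth of order at least l^(n-1). For 0 < m < n,
   the m-fold power of (l E - A)^-1 E acts on phi (ker N^(m+1)) as (-1)^m phi N^m, which is nonzero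
   and independent of l, so it cannot decay. Since E on the complementary block is the identity,
   every chain lies in the nilpotent block, where chains are the Jordan chains of N. *)

theory Submission
  imports Defs
begin

section \<open>Complex-linear maps, their iterates, and evaluation of resolvents\<close>

lemma bounded_clinear_linear: "bounded_clinear f \<Longrightarrow> linear f"
  by (simp add: bounded_clinear_def bounded_linear.linear)

lemma bounded_clinear_scaleC: "bounded_clinear f \<Longrightarrow> f (c *\<^sub>C x) = c *\<^sub>C f x"
  by (simp add: bounded_clinear_def)

lemma bounded_clinear_comp:
  "bounded_clinear f \<Longrightarrow> bounded_clinear g \<Longrightarrow> bounded_clinear (\<lambda>x. f (g x))"
  by (simp add: bounded_clinear_def bounded_linear_compose)

lemma bounded_clinear_funpow:
  fixes f :: "'a::complex_normed_vector \<Rightarrow> 'a"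
  shows "bounded_clinear f \<Longrightarrow> bounded_clinear (f ^^ k)"
proof (induction k)
  case 0
  show ?case
    by (simp add: bounded_clinear_def id_def bounded_linear_ident)
next
  case (Suc k)
  then show ?case
    by (simp add: bounded_clinear_comp comp_def)
qed

lemma funpow_eq_0_mono:
  fixes f :: "'a::zero \<Rightarrow> 'a"
  assumes "f 0 = 0" "(f ^^ k) x = 0" "k \<le> m"
  shows "(f ^^ m) x = 0"
  using assms(3)
proof (induction m rule: dec_induct)
  case base
  show ?case
    by (rule assms)
next
  case (step m)
  then show ?case
    using assms(1) by simp
qed

lemma compose_upto_const: "compose_upto (\<lambda>_. f) p = f ^^ Suc p"
proof -
  have "foldr (\<circ>) (replicate n f) id = f ^^ n" for n
    by (induction n) simp_all
  then show ?thesis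
    by (simp only: compose_upto_def map_replicate_const length_upt diff_zero)
qed

lemma bounded_clinear_resolvent:
  "l \<in> resolvent_set E D A \<Longrightarrow> bounded_clinear (resolvent E D A l)"
  by (simp add: resolvent_set_def)

lemma resolvent_eqI:
  assumes "l \<in> resolvent_set E D A" "x \<in> D" "l *\<^sub>C E x - A x = z"
  shows "resolvent E D A l z = x"
  using assms inv_into_f_f[of "\<lambda>x. l *\<^sub>C E x - A x" D x]
  by (auto simp: resolvent_def resolvent_set_def bij_betw_def)

text \<open>Taking all \<open>l k\<close> equal turns the product of operators into a power. Of the
  two radial estimates, the one for products of \<open>resolvent E D A l \<circ> E\<close> is
  kept.\<close>

lemma radial_bound_funpow:
  assumes "radial_bound E D A r"
  obtains \<omega> C where "C > 0"
    and "\<forall>l>\<omega>. complex_of_real l \<in> resolvent_set E D A"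
    and "\<forall>l>\<omega>.
      onorm ((resolvent E D A (complex_of_real l) \<circ> E) ^^ Suc r) \<le> C * (1 / \<bar>l - \<omega>\<bar>) ^ Suc r"
proof -
  obtain \<omega> C where "C > 0"
    and res: "\<forall>l>\<omega>. complex_of_real l \<in> resolvent_set E D A"
    and bound: "\<forall>l :: nat \<Rightarrow> real. (\<forall>k\<le>r. l k > \<omega>) \<longrightarrow>
      onorm (compose_upto (\<lambda>k. resolvent E D A (complex_of_real (l k)) \<circ> E) r)
        \<le> C * (\<Prod>k\<le>r. 1 / \<bar>l k - \<omega>\<bar>) \<and>
      onorm (compose_upto (\<lambda>k. E \<circ> resolvent E D A (complex_of_real (l k))) r)
        \<le> C * (\<Prod>k\<le>r. 1 / \<bar>l k - \<omega>\<bar>)"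
    using assms unfolding radial_bound_def by (elim exE conjE) (rule that)
  have "onorm ((resolvent E D A (complex_of_real l) \<circ> E) ^^ Suc r)
      \<le> C * (1 / \<bar>l - \<omega>\<bar>) ^ Suc r" if "l > \<omega>" for l
    using bound[rule_format, of "\<lambda>_. l"] that
    by (simp add: compose_upto_const del: funpow.simps)
  with \<open>C > 0\<close> res show thesis
    by (intro that) blast+
qed

text \<open>Telescoping sum. Once \<open>N ^^ n\<close> vanishes, the right-hand side is
  \<open>- u\<close>, so the negated sum solves \<open>l *\<^sub>C N x - x = u\<close>.\<close>

lemma geometric_sum_funpow:
  assumes "bounded_clinear N"
  shows "l *\<^sub>C N (\<Sum>k<n. l ^ k *\<^sub>C (N ^^ k) u) - (\<Sum>k<n. l ^ k *\<^sub>C (N ^^ k) u) =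
    l ^ n *\<^sub>C (N ^^ n) u - u"
proof (induction n)
  case 0
  show ?case
    by (simp add: linear_0[OF bounded_clinear_linear[OF assms]] scaleC_one)
next
  case (Suc n)
  let ?S = "\<Sum>k<n. l ^ k *\<^sub>C (N ^^ k) u" and ?t = "l ^ n *\<^sub>C (N ^^ n) u"
  have "l *\<^sub>C N (?S + ?t) - (?S + ?t) = (l *\<^sub>C N ?S - ?S) - ?t + l *\<^sub>C N ?t"
    by (simp add: linear_add[OF bounded_clinear_linear[OF assms]] scaleC_add_right)
  also have "\<dots> = l ^ Suc n *\<^sub>C (N ^^ Suc n) u - u"
    by (simp add: Suc bounded_clinear_scaleC[OF assms] scaleC_scaleC)
  finally show ?case
    by simp
qed

text \<open>Both growth estimates end here: a fixed vector whose norm is O(1/l) along arbitrarily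
  large l must vanish.\<close>

lemma norm_eq_zero_if_scaled_bounded:
  fixes x :: "'a::real_normed_vector"
  assumes "\<And>l. l > c \<Longrightarrow> l * norm x \<le> K"
  shows "x = 0"
proof (rule ccontr)
  assume "x \<noteq> 0"
  define l where "l = max (c + 1) (K / norm x + 1)"
  have "l > c" "l > K / norm x"
    by (auto simp: l_def)
  with \<open>x \<noteq> 0\<close> have "l * norm x > K"
    by (simp add: divide_less_eq)
  with assms[OF \<open>l > c\<close>] show False
    by simp
qed

text \<open>Collects what the index estimates use of a Weierstrass form. The assumption
  \<open>E_eq_psi\<close> expresses, without naming the complementary block, that \<open>E\<close>
  is injective there: whatever \<open>E\<close> sends into the range of \<open>\<psi>\<close>
  already lies in the range of \<open>\<phi>\<close>.\<close>

locale nilpotent_block =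
  fixes E A :: "'x::complex_normed_vector \<Rightarrow> 'z::complex_normed_vector" and D :: "'x set"
    and N :: "'w::complex_normed_vector \<Rightarrow> 'w" and n :: nat
    and \<phi> :: "'w \<Rightarrow> 'x" and \<psi> :: "'w \<Rightarrow> 'z"
  assumes E: "bounded_clinear E" and N: "bounded_clinear N"
    and degree: "nilpotency_degree N n"
    and phi: "bounded_clinear \<phi>" and inj_phi: "inj \<phi>" and phi_D: "\<phi> v \<in> D"
    and psi: "bounded_clinear \<psi>" and inj_psi: "inj \<psi>"
    and E_phi: "E (\<phi> v) = \<psi> (N v)" and A_phi: "A (\<phi> v) = \<psi> v"
    and E_eq_psi: "E x = \<psi> v \<Longrightarrow> x \<in> range \<phi>"
begin

lemmas linears = bounded_clinear_linear[OF N] bounded_clinear_linear[OF phi]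
  bounded_clinear_linear[OF psi]

lemma zero_simps [simp]: "N 0 = 0" "\<phi> 0 = 0" "\<psi> 0 = 0"
  using linears by (simp_all add: linear_0)

lemma phi_eq_0 [simp]: "\<phi> v = 0 \<longleftrightarrow> v = 0"
  using inj_phi zero_simps(2) by (metis injD)

lemma psi_eq_0 [simp]: "\<psi> v = 0 \<longleftrightarrow> v = 0"
  using inj_psi zero_simps(3) by (metis injD)

lemma funpow_N_eq_0: "n \<le> m \<Longrightarrow> (N ^^ m) v = 0"
  using degree zero_simps(1) unfolding nilpotency_degree_def by (metis funpow_eq_0_mono)

lemma ex_funpow_N_neq_0:
  assumes "n > 0"
  shows "\<exists>v. (N ^^ (n - 1)) v \<noteq> 0"
  using assms degree unfolding nilpotency_degree_def
  by (metis diff_less zero_less_one ext)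

section \<open>Chains and the chain index\<close>

lemma chain_length_le:
  assumes "is_chain E D A q x"
  shows "q \<le> n"
proof -
  have x1: "E (x 1) = 0" "x 1 \<noteq> 0" and "q \<ge> 1"
    and Ex: "\<And>k. k \<in> {1..<q} \<Longrightarrow> E (x (k + 1)) = A (x k)"
    using assms by (auto simp: is_chain_def)
  \<comment> \<open>Climb the chain: \<open>E (x 1)\<close> is \<open>\<psi> 0\<close>, and
    afterwards \<open>E\<close> of each entry is \<open>A\<close> of an entry already in the block,
    so \<open>E_eq_psi\<close> puts the next entry there too. Injectivity of \<open>\<psi>\<close>
    turns the chain relation into \<open>N w = v\<close>. Entries are numbered from 1, so entry
    \<open>Suc k\<close> goes with the power \<open>k\<close>.\<close>
  have "\<exists>v. x (Suc k) = \<phi> v \<and> \<phi> ((N ^^ k) v) = x 1" if "Suc k \<le> q" for k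
    using that
  proof (induction k)
    case 0
    have "x 1 \<in> range \<phi>"
      by (rule E_eq_psi[of _ 0]) (use x1 in simp)
    then show ?case
      by force
  next
    case (Suc k)
    then obtain v where v: "x (Suc k) = \<phi> v" "\<phi> ((N ^^ k) v) = x 1"
      by auto
    have *: "E (x (Suc (Suc k))) = \<psi> v"
      using Ex[of "Suc k"] Suc.prems v(1) by (simp add: A_phi)
    then obtain w where w: "x (Suc (Suc k)) = \<phi> w"
      using E_eq_psi by blast
    with * have "N w = v"
      using inj_psi by (simp add: E_phi inj_eq)
    with v(2) w show ?case
      by (auto simp: funpow_Suc_right simp del: funpow.simps)
  qed
  from this[of "q - 1"] \<open>q \<ge> 1\<close> obtain v where "\<phi> ((N ^^ (q - 1)) v) = x 1"
    by auto
  with x1(2) have "\<not> n \<le> q - 1"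
    using funpow_N_eq_0 by fastforce
  then show ?thesis
    by simp
qed

text \<open>Start from \<open>v\<close> with \<open>N ^^ (n - 1)\<close> nonzero at \<open>v\<close>
  and read its Jordan chain backwards: entry \<open>k\<close> is
  \<open>\<phi> ((N ^^ (n - k)) v)\<close>. The first entry is annihilated by \<open>E\<close>
  because \<open>N ^^ n\<close> is zero.\<close>

lemma ex_chain:
  assumes "n > 0"
  shows "\<exists>x. is_chain E D A n x"
proof -
  obtain v where v: "(N ^^ (n - 1)) v \<noteq> 0"
    using ex_funpow_N_neq_0[OF assms] by blast
  have neq: "(N ^^ (n - k)) v \<noteq> 0" if "1 \<le> k" "k \<le> n" for k
  proof
    assume "(N ^^ (n - k)) v = 0"
    then have "(N ^^ (n - 1)) v = 0"
      by (rule funpow_eq_0_mono[rotated]) (use that in auto)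
    with v show False ..
  qed
  have N_step: "N ((N ^^ (n - (k + 1))) v) = (N ^^ (n - k)) v" if "k < n" for k
    using Suc_diff_Suc[OF that] by (simp flip: funpow.simps(2)[THEN fun_cong, simplified comp_def])
  have "is_chain E D A n (\<lambda>k. \<phi> ((N ^^ (n - k)) v))"
    unfolding is_chain_def
  proof (intro conjI ballI)
    show "E (\<phi> ((N ^^ (n - 1)) v)) = 0"
      using N_step[of 0] assms by (simp add: E_phi funpow_N_eq_0)
  qed (use assms neq N_step in \<open>auto simp: phi_D A_phi E_phi\<close>)
  then show ?thesis
    by (rule exI[of _ "\<lambda>k. \<phi> ((N ^^ (n - k)) v)"])
qed

lemma is_chain_index: "is_chain_index E D A n"
proof -
  let ?L = "{q. \<exists>x. is_chain E D A q x}"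
  have le: "q \<le> n" if "q \<in> ?L" for q
    using that chain_length_le by blast
  then have "bdd_above ?L"
    by (rule bdd_aboveI)
  moreover have "n = (if ?L = {} then 0 else Sup ?L)"
  proof (cases "n = 0")
    case True
    \<comment> \<open>Chains have length at least 1, so the bound by 0 excludes them all and the
      convention for the empty set applies.\<close>
    have "?L = {}"
      using le True unfolding is_chain_def by fastforce
    with True show ?thesis
      by simp
  next
    case False
    then have "n \<in> ?L"
      using ex_chain by blast
    then have "Sup ?L = n"
      using le by (rule cSup_eq_maximum)
    with \<open>n \<in> ?L\<close> show ?thesis
      by auto
  qed
  ultimately show ?thesis
    by (simp add: is_chain_index_def Let_def)
qed

section \<open>The resolvent on the nilpotent block and its growth\<close>

lemma resolvent_psi:
  assumes "l \<in> resolvent_set E D A"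
  shows "resolvent E D A l (\<psi> u) = \<phi> (- (\<Sum>k<n. l ^ k *\<^sub>C (N ^^ k) u))"
proof (rule resolvent_eqI[OF assms phi_D])
  let ?S = "\<Sum>k<n. l ^ k *\<^sub>C (N ^^ k) u"
  \<comment> \<open>The pencil \<open>l E - A\<close> composed with \<open>\<phi>\<close> is
    \<open>\<psi>\<close> composed with \<open>l N - I\<close>, which the finite geometric sum
    inverts up to sign.\<close>
  have "l *\<^sub>C E (\<phi> (- ?S)) - A (\<phi> (- ?S)) = \<psi> (- (l *\<^sub>C N ?S - ?S))"
    by (simp add: E_phi A_phi linear_neg[OF linears(1)] linear_neg[OF linears(3)]
        linear_diff[OF linears(3)] bounded_clinear_scaleC[OF psi])
  also have "- (l *\<^sub>C N ?S - ?S) = u"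
    by (simp only: geometric_sum_funpow[OF N]) (simp add: funpow_N_eq_0)
  finally show "l *\<^sub>C E (\<phi> (- ?S)) - A (\<phi> (- ?S)) = \<psi> u" .
qed

text \<open>If r were at most m = n - 1, the resolvent at \<open>\<psi> v\<close> would be
  O(l^(m-1)). It is a polynomial in l whose terms below degree m are also O(l^(m-1)), so its
  coefficient of degree m, up to sign \<open>\<phi> ((N ^^ m) v)\<close>, would vanish.\<close>

lemma le_resolvent_growth:
  assumes "resolvent_growth E D A r"
  shows "n \<le> r"
proof (rule ccontr)
  assume "\<not> n \<le> r"
  then obtain m where m: "n = Suc m" "r \<le> m"
    by (cases n) auto
  obtain v where v: "(N ^^ m) v \<noteq> 0"
    using ex_funpow_N_neq_0 m(1) by auto
  obtain \<omega> C where "C > 0"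
    and res: "\<And>l. l > \<omega> \<Longrightarrow> complex_of_real l \<in> resolvent_set E D A"
    and growth: "\<And>l. l > \<omega> \<Longrightarrow>
      onorm (resolvent E D A (complex_of_real l)) \<le> C * \<bar>l\<bar> powi (int r - 1)"
    using assms by (auto simp: resolvent_growth_def)
  define a where "a k = norm (\<phi> ((N ^^ k) v))" for k
  \<comment> \<open>The first constant comes from the growth hypothesis, the sum from the terms of
    lower degree. Taking l above 1 makes its powers increasing.\<close>
  have "l * norm (\<phi> ((N ^^ m) v)) \<le> C * norm (\<psi> v) + (\<Sum>k<m. a k)"
    if l: "l > max \<omega> 1" for l
  proof -
    let ?T = "\<lambda>k. complex_of_real l ^ k *\<^sub>C \<phi> ((N ^^ k) v)"
    let ?R = "resolvent E D A (complex_of_real l) (\<psi> v)"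
    have norm_T: "norm (?T k) = l ^ k * a k" for k
      using l by (simp add: norm_scaleC norm_power a_def)
    have mono: "l ^ k \<le> l ^ m" if "k \<le> m" for k
      using that l by (simp add: power_increasing)
    have R: "?R = - (\<Sum>k<Suc m. ?T k)"
      using l m(1) by (simp add: resolvent_psi[OF res] linear_neg[OF linears(2)]
          linear_diff[OF linears(2)] linear_sum[OF linears(2)] bounded_clinear_scaleC[OF phi])
    have "norm ?R \<le> onorm (resolvent E D A (complex_of_real l)) * norm (\<psi> v)"
      using l bounded_clinear_resolvent[OF res[of l]]
      by (intro onorm) (auto simp: bounded_clinear_def)
    also have "\<dots> \<le> C * \<bar>l\<bar> powi (int r - 1) * norm (\<psi> v)"
      using l by (intro mult_right_mono growth) auto
    \<comment> \<open>The factor l raises the exponent r - 1 to r, so that natural powers suffice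
      even when r = 0.\<close>
    finally have "l * norm ?R \<le> l * (C * \<bar>l\<bar> powi (int r - 1) * norm (\<psi> v))"
      using l by (intro mult_left_mono) auto
    also have "\<dots> = l ^ r * (C * norm (\<psi> v))"
      using l by (simp add: power_int_diff)
    also have "\<dots> \<le> l ^ m * (C * norm (\<psi> v))"
      using \<open>C > 0\<close> m(2) by (intro mult_right_mono mono) auto
    finally have 1: "l * norm ?R \<le> l ^ m * (C * norm (\<psi> v))" .
    have "l * norm (\<Sum>k<m. ?T k) \<le> l * (\<Sum>k<m. l ^ k * a k)"
      using l norm_sum[of ?T "{..<m}"] by (intro mult_left_mono) (auto simp: norm_T)
    also have "\<dots> = (\<Sum>k<m. l ^ Suc k * a k)"
      by (simp add: sum_distrib_left mult.assoc)
    also have "\<dots> \<le> (\<Sum>k<m. l ^ m * a k)"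
      by (intro sum_mono mult_right_mono mono) (auto simp: a_def)
    finally have 2: "l * norm (\<Sum>k<m. ?T k) \<le> l ^ m * (\<Sum>k<m. a k)"
      by (simp add: sum_distrib_left)
    have "?T m = - ?R - (\<Sum>k<m. ?T k)"
      by (simp add: R)
    then have "norm (?T m) \<le> norm ?R + norm (\<Sum>k<m. ?T k)"
      by (metis norm_minus_cancel norm_triangle_ineq4)
    then have "l * norm (?T m) \<le> l * norm ?R + l * norm (\<Sum>k<m. ?T k)"
      using l by (simp flip: distrib_left)
    with 1 2 have "l ^ m * (l * a m) \<le> l ^ m * (C * norm (\<psi> v) + (\<Sum>k<m. a k))"
      by (simp add: norm_T algebra_simps)
    then show ?thesis
      using l by (simp add: a_def)
  qed
  then have "\<phi> ((N ^^ m) v) = 0"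
    by (rule norm_eq_zero_if_scaled_bounded)
  with v show False
    by simp
qed

text \<open>One application sends \<open>\<phi> u\<close> to \<open>- \<phi> S\<close>, where
  \<open>S\<close> is \<open>N u\<close> plus l-dependent terms in higher powers of
  \<open>N\<close>. The remaining applications and the kernel condition on \<open>u\<close> remove
  those terms, so the result does not depend on l.\<close>

lemma funpow_resolvent_E:
  assumes "l \<in> resolvent_set E D A" "(N ^^ Suc m) u = 0"
  shows "((resolvent E D A l \<circ> E) ^^ m) (\<phi> u) = (- 1) ^ m *\<^sub>C \<phi> ((N ^^ m) u)"
  using assms(2)
proof (induction m arbitrary: u)
  case 0
  then show ?case
    by (simp add: scaleC_one)
next
  case (Suc m)
  define S where "S = (\<Sum>k<n. l ^ k *\<^sub>C (N ^^ k) (N u))"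
  have S: "S = N u + l *\<^sub>C N S"
    using geometric_sum_funpow[OF N, where l = l and n = n and u = "N u"]
    by (simp add: S_def funpow_N_eq_0 algebra_simps)
  note pow = bounded_clinear_funpow[OF N]
  have vanish: "(N ^^ Suc m) S = 0"
  proof -
    have "(N ^^ Suc m) ((N ^^ k) (N u)) = 0" for k
    proof -
      have "(N ^^ Suc m) ((N ^^ k) (N u)) = (N ^^ (Suc m + k + 1)) u"
        by (simp only: funpow_add comp_apply) simp
      also have "\<dots> = 0"
        by (rule funpow_eq_0_mono[OF _ Suc.prems]) auto
      finally show ?thesis .
    qed
    then show ?thesis
      unfolding S_def linear_sum[OF bounded_clinear_linear[OF pow]]
      by (simp add: bounded_clinear_scaleC[OF pow] del: funpow.simps)
  qed
  \<comment> \<open>Apply \<open>N ^^ m\<close> to the fixed-point equation \<open>S\<close>; the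
    term carrying the factor l contains \<open>(N ^^ Suc m) S\<close>, which is zero by
    \<open>vanish\<close>.\<close>
  have "(N ^^ m) S = (N ^^ m) (N u) + l *\<^sub>C (N ^^ m) (N S)"
    by (subst S) (simp add: linear_add[OF bounded_clinear_linear[OF pow]]
        bounded_clinear_scaleC[OF pow])
  then have lead: "(N ^^ m) S = (N ^^ Suc m) u"
    using vanish by (simp add: funpow_Suc_right del: funpow.simps)
  have "((resolvent E D A l \<circ> E) ^^ Suc m) (\<phi> u) = ((resolvent E D A l \<circ> E) ^^ m) (\<phi> (- S))"
    by (simp add: funpow_Suc_right E_phi resolvent_psi[OF assms(1)] S_def del: funpow.simps)
  also have "\<dots> = (- 1) ^ m *\<^sub>C \<phi> ((N ^^ m) (- S))"
    using vanish by (intro Suc.IH) (simp add: linear_neg[OF bounded_clinear_linear[OF pow]]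
        del: funpow.simps)
  also have "\<dots> = (- 1) ^ Suc m *\<^sub>C \<phi> ((N ^^ Suc m) u)"
    by (simp add: linear_neg[OF bounded_clinear_linear[OF pow]] lead linear_neg[OF linears(2)]
        del: funpow.simps)
  finally show ?case .
qed

lemma le_radial_bound:
  assumes "radial_bound E D A r"
  shows "n \<le> r + 1"
proof (rule ccontr)
  assume "\<not> n \<le> r + 1"
  then have n: "Suc r + (n - 1 - Suc r) = n - 1" "n > 0"
    by auto
  obtain v where v: "(N ^^ (n - 1)) v \<noteq> 0"
    using ex_funpow_N_neq_0[OF n(2)] by blast
  \<comment> \<open>Since n is at least r + 2, the exponent is a true difference. It is chosen so
    that \<open>N ^^ Suc r\<close> sends \<open>u\<close> to the last nonzero vector of the Jordan
    chain of \<open>v\<close>, and one more \<open>N\<close> kills it.\<close>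
  define u where "u = (N ^^ (n - 1 - Suc r)) v"
  have u: "(N ^^ Suc r) u = (N ^^ (n - 1)) v"
    unfolding u_def by (metis comp_apply funpow_add n(1))
  have u0: "(N ^^ Suc (Suc r)) u = 0"
  proof -
    have "(N ^^ Suc (Suc r)) u = N ((N ^^ (n - 1)) v)"
      using u by simp
    also have "\<dots> = (N ^^ Suc (n - 1)) v"
      by simp
    also have "\<dots> = 0"
      by (rule funpow_N_eq_0) simp
    finally show ?thesis .
  qed
  obtain \<omega> C where "C > 0"
    and res: "\<forall>l>\<omega>. complex_of_real l \<in> resolvent_set E D A"
    and bound: "\<forall>l>\<omega>.
      onorm ((resolvent E D A (complex_of_real l) \<circ> E) ^^ Suc r) \<le> C * (1 / \<bar>l - \<omega>\<bar>) ^ Suc r"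
    by (rule radial_bound_funpow[OF assms])
  \<comment> \<open>The spectral parameter is \<open>\<omega> + l\<close>, so its distance to
    \<open>\<omega>\<close> is l. As l exceeds 1, the factor \<open>(1 / l) ^ Suc r\<close> is at
    most \<open>1 / l\<close>, and this decay contradicts the constant value on
    \<open>\<phi> u\<close>.\<close>
  have "l * norm (\<phi> ((N ^^ Suc r) u)) \<le> C * norm (\<phi> u)" if l: "l > 1" for l
  proof -
    let ?F = "(resolvent E D A (complex_of_real (\<omega> + l)) \<circ> E) ^^ Suc r"
    have l_res: "complex_of_real (\<omega> + l) \<in> resolvent_set E D A"
      using l by (intro res[rule_format]) simp
    then have "bounded_clinear ?F"
      unfolding comp_def
      by (rule bounded_clinear_funpow[OF bounded_clinear_comp[OF bounded_clinear_resolvent E]])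
    then have "norm (?F (\<phi> u)) \<le> onorm ?F * norm (\<phi> u)"
      by (intro onorm) (simp only: bounded_clinear_def)
    also have "\<dots> \<le> C * (1 / l) ^ Suc r * norm (\<phi> u)"
      using bound[rule_format, of "\<omega> + l"] l
      by (intro mult_right_mono) (simp_all del: funpow.simps power_Suc of_real_add)
    also have "\<dots> \<le> C * (1 / l) * norm (\<phi> u)"
      using l \<open>C > 0\<close> power_decreasing[of 1 "Suc r" "1 / l"]
      by (intro mult_right_mono mult_left_mono) auto
    also have "?F (\<phi> u) = (- 1) ^ Suc r *\<^sub>C \<phi> ((N ^^ Suc r) u)"
      by (rule funpow_resolvent_E[OF l_res u0])
    finally have "norm (\<phi> ((N ^^ Suc r) u)) \<le> C * norm (\<phi> u) / l"
      by (simp add: norm_scaleC norm_power del: funpow.simps)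
    then show ?thesis
      using l by (simp add: pos_le_divide_eq mult.commute del: funpow.simps)
  qed
  then have "\<phi> ((N ^^ Suc r) u) = 0"
    by (intro norm_eq_zero_if_scaled_bounded[of 1]) simp
  with u v show False
    by simp
qed

end

section \<open>From the Weierstrass form to the nilpotent block\<close>

lemma bounded_clinear_Pair_0: "bounded_clinear (Pair 0)"
  by (simp add: bounded_clinear_def scaleC_prod_def
      bounded_linear_Pair[OF bounded_linear_zero bounded_linear_ident, unfolded id_def])

text \<open>The embeddings are the second summand followed by \<open>inv P\<close> and
  \<open>inv Q\<close>. For \<open>E_eq_psi\<close>, the upper block of \<open>E\<close> is the
  identity, so if \<open>Q (E x)\<close> has first component 0 then so does
  \<open>P x\<close>.\<close>

lemma weierstrass_form_nilpotent_block:
  assumes E: "bounded_clinear E" and W: "weierstrass_form E D A D1 A1 N"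
    and deg: "nilpotency_degree N n"
  shows "\<exists>\<phi> \<psi>. nilpotent_block E A D N n \<phi> \<psi>"
proof -
  obtain P Q where PQ: "bounded_isomorphism P" "bounded_isomorphism Q"
    and N: "bounded_clinear N" and A1: "clinear_on D1 A1"
    and EPQ: "\<And>x. E x = inv Q (case P x of (u, v) \<Rightarrow> (u, N v))"
    and D: "D = P -` (D1 \<times> UNIV)"
    and APQ: "\<And>x. x \<in> D \<Longrightarrow> A x = inv Q (case P x of (u, v) \<Rightarrow> (A1 u, v))"
    using W by (auto simp: weierstrass_form_def pencil_equiv_def)
  have bij: "bij P" "bij Q" and bounded: "bounded_clinear (inv P)" "bounded_clinear (inv Q)"
    using PQ by (auto simp: bounded_isomorphism_def)
  note P_inv = surj_f_inv_f[OF bij_is_surj[OF bij(1)]] inv_f_f[OF bij_is_inj[OF bij(1)]]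
  have inj: "inj (inv P)" "inj (inv Q)"
    using bij by (simp_all add: bij_imp_bij_inv bij_is_inj)
  \<comment> \<open>\<open>A1\<close> is linear only on \<open>D1\<close>, so
    \<open>A1 0 = 0\<close> is derived there. It makes \<open>A\<close> send
    \<open>inv P (0, v)\<close> to \<open>inv Q (0, v)\<close>.\<close>
  have "0 \<in> D1"
    using A1 by (simp add: clinear_on_def complex_vector.subspace_0)
  then have "A1 (0 + 0) = A1 0 + A1 0"
    using A1 unfolding clinear_on_def by blast
  then have "A1 0 = 0"
    by simp
  have in_D: "inv P (0, v) \<in> D" for v
    using \<open>0 \<in> D1\<close> by (simp add: D P_inv)
  have "nilpotent_block E A D N n (\<lambda>v. inv P (0, v)) (\<lambda>v. inv Q (0, v))"
  proof
    fix x v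
    assume "E x = inv Q (0, v)"
    then have "fst (P x) = 0"
      using inj(2) by (auto simp: EPQ inj_eq split: prod.splits)
    then have "x = inv P (0, snd (P x))"
      using P_inv(2)[of x] by (metis prod.collapse)
    then show "x \<in> range (\<lambda>v. inv P (0, v))"
      by blast
  qed (use E N deg in_D inj \<open>A1 0 = 0\<close> in \<open>auto simp: EPQ APQ P_inv inj_on_def
      intro!: bounded_clinear_comp[OF _ bounded_clinear_Pair_0] bounded\<close>)
  then show ?thesis
    by blast
qed

text \<open>Serves the case of an absent \<open>N\<close>: the first entry of a chain is a nonzero
  kernel vector of \<open>E\<close>.\<close>

lemma is_chain_index_0_if_inj:
  assumes "\<And>x. E x = 0 \<Longrightarrow> x = 0"
  shows "is_chain_index E D A 0"
proof -
  have "{q. \<exists>x. is_chain E D A q x} = {}"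
    using assms by (auto simp: is_chain_def)
  then show ?thesis
    by (simp add: is_chain_index_def)
qed

lemma pencil_equiv_id_inj:
  fixes D1 :: "'y::complex_normed_vector set"
  assumes "pencil_equiv E D A id D1 A1" "E x = 0"
  shows "x = 0"
proof -
  obtain P :: "_ \<Rightarrow> 'y" and Q where PQ: "bounded_isomorphism P" "bounded_isomorphism Q"
    and EPQ: "\<And>x. E x = inv Q (P x)"
    using assms(1) by (auto simp: pencil_equiv_def)
  have bij: "bij P" "bij Q" and bounded: "bounded_clinear P" "bounded_clinear (inv Q)"
    using PQ by (auto simp: bounded_isomorphism_def)
  have "inj (\<lambda>x. inv Q (P x))"
    using inj_compose[of "inv Q" P] bij by (simp add: bij_imp_bij_inv bij_is_inj comp_def)
  moreover have "inv Q (P 0) = 0"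
    using bounded by (simp add: linear_0[OF bounded_clinear_linear])
  ultimately show ?thesis
    using assms(2) by (metis EPQ injD)
qed

lemma nilpotency_index_bounds:
  assumes "bounded_clinear E"
    and "is_nilpotency_index TYPE('y::complex_hilbert) TYPE('w::complex_hilbert) E D A n"
  shows "is_chain_index E D A n"
    and "resolvent_growth E D A r \<Longrightarrow> n \<le> r"
    and "radial_bound E D A r \<Longrightarrow> n \<le> r + 1"
proof -
  consider (block) N :: "'w \<Rightarrow> 'w" and \<phi> \<psi> where "nilpotent_block E A D N n \<phi> \<psi>"
    | (absent) D1 :: "'y set" and A1 where "n = 0" "pencil_equiv E D A id D1 A1"
    using assms weierstrass_form_nilpotent_block[OF assms(1)]
    unfolding is_nilpotency_index_def by metis
  then have "is_chain_index E D A n \<and> (resolvent_growth E D A r \<longrightarrow> n \<le> r) \<and>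
    (radial_bound E D A r \<longrightarrow> n \<le> r + 1)"
  proof cases
    case block
    then interpret nilpotent_block E A D N n \<phi> \<psi> .
    show ?thesis
      using is_chain_index le_resolvent_growth le_radial_bound by blast
  next
    \<comment> \<open>Here n = 0, so both inequalities are immediate, and \<open>E\<close> is
      injective as a composition of bijections.\<close>
    case absent
    then show ?thesis
      using is_chain_index_0_if_inj[OF pencil_equiv_id_inj[OF absent(2)]] by simp
  qed
  then show "is_chain_index E D A n" "resolvent_growth E D A r \<Longrightarrow> n \<le> r"
    "radial_bound E D A r \<Longrightarrow> n \<le> r + 1"
    by auto
qed

theorem proposition6p3:
  fixes E A :: "'x::complex_banach \<Rightarrow> 'z::complex_banach"
    and D :: "'x set"
  assumes "bounded_clinear E"
    and "clinear_on D A"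
    and "closed_operator D A"
    and "closure D = UNIV"
    and "resolvent_set E D A \<noteq> {}"
  shows "(\<forall>n. is_nilpotency_index TYPE('y::complex_hilbert) TYPE('w::complex_hilbert) E D A n \<longrightarrow>
           (\<exists>c. is_chain_index E D A c \<and> n = c)) \<and>
         (\<forall>n r. is_nilpotency_index TYPE('y) TYPE('w) E D A n \<and> is_resolvent_index E D A r \<longrightarrow>
           r \<ge> n) \<and>
         (\<forall>n r. is_nilpotency_index TYPE('y) TYPE('w) E D A n \<and> is_radiality_index E D A r \<longrightarrow>
           r + 1 \<ge> n)"
  using nilpotency_index_bounds[OF assms(1)]
  unfolding is_resolvent_index_def is_radiality_index_def by blast

end
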